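(* Let $U, Y, V_U, J, S, \widehat{J}, \psi$ and, for each $h>0$, $U_h, Y_h, S_h, \widehat{J}_h, \widehat{j}_h, \psi_h, \Pi_h$ be as described in the context. Let $\tau>0$. Suppose the following. (1) $\widehat{U}$ is a real reflexive Banach space, $\widehat{U}\subset U$, and the map $\iota_{\widehat{U},U}\colon\widehat{U}\to U$, $w\mapsto w$, is continuous with dense image in $U$. There is a nondecreasing function $\rho_{\Pi}\colon[0,\infty)\to[0,\infty)$ with $\rho_\Pi(0)=0$ and $\|\Pi_h v-v\|_U\le\rho_\Pi(h)\|v\|_{\widehat{U}}$ for all $v\in\widehat{U}$ and $h>0$. (2) $W_U\subset V_U$ is a bounded set with $\mathrm{dom}(\psi)\subset W_U$ and $\mathrm{dom}(\psi_h)\subset W_U$ for all $h>0$. The gradient $\nabla\widehat{J}$ is Lipschitz continuous on $W_U$ with Lipschitz constant $L_{\nabla\widehat{J}}>0$. There is $\ell_{\nabla\widehat{J}}>0$ such that for all $h>0$ and $v_h\in W_U\cap U_h$, $\nabla\widehat{J}(v_h)\in\widehat{U}$ and $\|\nabla\widehat{J}(v_h)\|_{\widehat{U}}\le\ell_{\nabla\widehat{J}}$. There is a nondecreasing function $\rho_{\nabla\widehat{J}}\colon[0,\infty)\to[0,\infty)$ with $\rho_{\nabla\widehat{J}}(0)=0$ and $\|\nabla\widehat{J}_h(v_h)-\nabla\widehat{J}(v_h)\|_U\le\rho_{\nabla\widehat{J}}(h)$ for all $v_h\in W_U\cap U_h$ and $h>0$. (3) There is a nondecreasing function $\rho_{\mathrm{prox}}\colon[0,\infty)\to[0,\infty)$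 with $\rho_{\mathrm{prox}}(0)=0$ and $\|\mathrm{prox}_{\psi/\tau}(v_h)-\mathrm{prox}_{\psi_h/\tau}(v_h)\|_U\le\rho_{\mathrm{prox}}(h)$ for all $v_h\in U_h$ and $h>0$. Then for all $h>0$ and all $u_h\in W_U\cap U_h$, $$\chi_{\mathrm{can}}(u_h;\tau)\le\chi_{\mathrm{can},h}(u_h;\tau)+\frac1\tau\,\rho_{\nabla\widehat{J}}(h)+\rho_{\mathrm{prox}}(h)+\frac1\tau\,\rho_\Pi(h)\,\ell_{\nabla\widehat{J}}.$$
   Context: Setting. $U$ is a real separable Hilbert space and $Y$ a real separable Banach space. $\psi\colon U\to(-\infty,\infty]$ is proper, closed (lower semicontinuous) and convex, with $\mathrm{dom}(\psi)=\{u\in U:\psi(u)<\infty\}$. $V_U\subset U$ is open with $\mathrm{dom}(\psi)\subset V_U$. $J\colon Y\times U\to\mathbb{R}$ and $S\colon V_U\to Y$ are continuously differentiable. Define $\widehat{J}\colon V_U\to\mathbb{R}$, $\widehat{J}(u)=J(S(u),u)$. Discretization. For each $h>0$, $U_h$ is a closed linear subspace of $U$ (with the inner product of $U$), $Y_h$ is a linear subspace of $Y$ (with the norm of $Y$), $\psi_h\colon U_h\to(-\infty,\infty]$ is proper, closed and convex with $\mathrm{dom}(\psi_h)\subset V_U$, and $S_h\colon V_U\to Y_h$ is continuously differentiable. Define $\widehat{J}_h\colon V_U\to\mathbb{R}$, $\widehat{J}_h(u)=J(S_h(u),u)$, and $\widehat{j}_h\colon U_h\cap V_U\to\mathbb{R}$,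 $\widehat{j}_h(u_h)=\widehat{J}_h(u_h)$. Gradients $\nabla\widehat{J},\nabla\widehat{J}_h$ are Riesz representatives of the derivatives in $U$; $\nabla\widehat{j}_h$ is the Riesz representative in $U_h$. $\Pi_h\colon U\to U_h$ is the orthogonal projection onto $U_h$; one has $\nabla\widehat{j}_h(u_h)=\Pi_h\nabla\widehat{J}_h(u_h)$. Proximity operator. For a real Hilbert space $H$ and proper, closed, convex $\phi\colon H\to(-\infty,\infty]$, $\mathrm{prox}_\phi(u)=\mathrm{argmin}_{v\in H}\,\tfrac12\|v-u\|_H^2+\phi(v)$. Here $\mathrm{prox}_{\psi/\tau}$ is taken in $H=U$ and $\mathrm{prox}_{\psi_h/\tau}$ in $H=U_h$. Criticality measures. $\chi_{\mathrm{can}}(u;\tau)=\|u-\mathrm{prox}_{\psi/\tau}(u-(1/\tau)\nabla\widehat{J}(u))\|_U$ for $u\in V_U$ and $\chi_{\mathrm{can},h}(u_h;\tau)=\|u_h-\mathrm{prox}_{\psi_h/\tau}(u_h-(1/\tau)\nabla\widehat{j}_h(u_h))\|_U$ for $u_h\in U_h\cap V_U$. *)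

theory Defs
  imports "HOL-Analysis.Analysis"
begin

section \<open>Continuously differentiable maps between normed spaces\<close>

text \<open>
  Continuous Frechet differentiability of \<open>f : S \<rightarrow> T\<close>, where \<open>S\<close> is open and \<open>T\<close> is a linear
  subspace with the inherited norm. The derivative is continuous in operator norm. \<open>T\<close> need not be
  closed, so that the derivative takes its values in \<open>T\<close> has to be required.
\<close>

definition C1_into ::
  "('a::real_normed_vector \<Rightarrow> 'b::real_normed_vector) \<Rightarrow> 'a set \<Rightarrow> 'b set \<Rightarrow> bool" where
  "C1_into f S T \<longleftrightarrow> f ` S \<subseteq> T \<and>
     (\<exists>f' :: 'a \<Rightarrow> 'a \<Rightarrow>\<^sub>L 'b.
        (\<forall>x\<in>S. (f has_derivative blinfun_apply (f' x)) (at x) \<and> range (blinfun_apply (f' x)) \<subseteq> T) \<and>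
        continuous_on S f')"

section \<open>Reflexive spaces\<close>

definition reflexive_space :: "'a::real_normed_vector itself \<Rightarrow> bool" where
  "reflexive_space (_ :: 'a itself) \<longleftrightarrow>
     (\<forall>F :: ('a \<Rightarrow>\<^sub>L real) \<Rightarrow>\<^sub>L real. \<exists>x :: 'a. \<forall>f. blinfun_apply F f = blinfun_apply f x)"

section \<open>Extended real valued convex functions on a subspace\<close>

text \<open>
  Below, \<open>H\<close> is a closed linear subspace, regarded as a Hilbert space of its own. A function on \<open>H\<close>
  is a total function of which only the values on \<open>H\<close> are used.
\<close>

definition edom_on :: "'a set \<Rightarrow> ('a \<Rightarrow> ereal) \<Rightarrow> 'a set" where
  "edom_on H \<phi> = {u \<in> H. \<phi> u < \<infinity>}"

definition proper_on :: "'a set \<Rightarrow> ('a \<Rightarrow> ereal) \<Rightarrow> bool" where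
  "proper_on H \<phi> \<longleftrightarrow> (\<forall>u\<in>H. \<phi> u \<noteq> -\<infinity>) \<and> edom_on H \<phi> \<noteq> {}"

definition lsc_on :: "'a::topological_space set \<Rightarrow> ('a \<Rightarrow> ereal) \<Rightarrow> bool" where
  "lsc_on H \<phi> \<longleftrightarrow> (\<forall>u\<in>H. \<phi> u \<le> Liminf (at u within H) \<phi>)"

definition econvex_on :: "'a::real_vector set \<Rightarrow> ('a \<Rightarrow> ereal) \<Rightarrow> bool" where
  "econvex_on H \<phi> \<longleftrightarrow> convex H \<and>
     (\<forall>x\<in>H. \<forall>y\<in>H. \<forall>s>0. \<forall>t>0. s + t = 1 \<longrightarrow>
        \<phi> (s *\<^sub>R x + t *\<^sub>R y) \<le> ereal s * \<phi> x + ereal t * \<phi> y)"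

definition proper_closed_convex_on :: "'a::real_normed_vector set \<Rightarrow> ('a \<Rightarrow> ereal) \<Rightarrow> bool" where
  "proper_closed_convex_on H \<phi> \<longleftrightarrow> proper_on H \<phi> \<and> lsc_on H \<phi> \<and> econvex_on H \<phi>"

section \<open>Proximity operator, gradient and orthogonal projection\<close>

definition prox_on :: "'a::real_inner set \<Rightarrow> ('a \<Rightarrow> ereal) \<Rightarrow> 'a \<Rightarrow> 'a" where
  "prox_on H \<phi> u = arg_min_on (\<lambda>v. ereal ((1/2) * (norm (v - u))\<^sup>2) + \<phi> v) H"

text \<open>
  The Riesz representative in \<open>H\<close> of the derivative at \<open>u \<in> H\<close> of the restriction of \<open>f\<close> to \<open>H\<close>
  (or to a relatively open neighbourhood of \<open>u\<close> in \<open>H\<close>). For \<open>H = UNIV\<close> it is the \<open>g\<close> with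
  \<open>GDERIV f u :> g\<close>.
\<close>

definition grad_on :: "'a::real_inner set \<Rightarrow> ('a \<Rightarrow> real) \<Rightarrow> 'a \<Rightarrow> 'a" where
  "grad_on H f u = (THE g. g \<in> H \<and> (f has_derivative (\<lambda>v. v \<bullet> g)) (at u within H))"

definition orth_proj :: "'a::real_inner set \<Rightarrow> 'a \<Rightarrow> 'a" where
  "orth_proj H u = (THE p. p \<in> H \<and> (\<forall>v\<in>H. orthogonal (u - p) v))"

section \<open>Reduced objective and criticality measure\<close>

definition reduced_obj :: "('y \<times> 'u \<Rightarrow> real) \<Rightarrow> ('u \<Rightarrow> 'y) \<Rightarrow> 'u \<Rightarrow> real" where
  "reduced_obj J S u = J (S u, u)"

definition chi_can ::
  "'u::real_inner set \<Rightarrow> ('u \<Rightarrow> ereal) \<Rightarrow> ('u \<Rightarrow> real) \<Rightarrow> 'u \<Rightarrow> real \<Rightarrow> real" where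
  "chi_can H \<psi> f u \<tau> =
     norm (u - prox_on H (\<lambda>v. \<psi> v / ereal \<tau>) (u - (1/\<tau>) *\<^sub>R grad_on H f u))"

section \<open>Error rate functions\<close>

definition rate_fun :: "(real \<Rightarrow> real) \<Rightarrow> bool" where
  "rate_fun \<rho> \<longleftrightarrow> \<rho> ` {0..} \<subseteq> {0..} \<and> mono_on {0..} \<rho> \<and> \<rho> 0 = 0"

end

theory Submission
  imports Defs
begin

text \<open>
  The triangle inequality compares the two proximal points through
  \<open>prox\<^bsub>\<psi>/\<tau>\<^esub>\<close> evaluated at the discrete argument; since \<open>prox\<close> is nonexpansive, the remaining
  error is \<open>1/\<tau>\<close> times the distance of \<open>\<Pi>\<^sub>h \<nabla>J\<^sub>h(u)\<close> to \<open>\<nabla>J(u)\<close>, which is split at \<open>\<Pi>\<^sub>h \<nabla>J(u)\<close>.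

  Existence of proximal points, of orthogonal projections and of Riesz representatives are all
  instances of one fact: \<open>\<parallel>v - u\<parallel>\<^sup>2/2 + f v\<close> attains its minimum whenever \<open>f\<close> is convex with closed
  epigraph. Affine minorants (and hence Hahn-Banach) are avoided: closedness bounds \<open>f\<close> from below
  near one point and convexity turns this into a bound that decreases at most linearly.
\<close>

section \<open>Minimizers of quadratically perturbed convex functions\<close>

text \<open>The point one unit below the graph at \<open>x0\<close> is outside the closed epigraph,
  hence so is a ball around it, which keeps \<open>f\<close> above \<open>f x0 - 1\<close> near
  \<open>x0\<close>. A steeper than linear fall further out would, by convexity along the segment
  from \<open>x0\<close>, already show inside that ball.\<close>

lemma convex_closed_epigraph_lower_bound:
  fixes f :: "'a::real_normed_vector \<Rightarrow> real"
  assumes f: "convex_on D f" and cl: "closed (epigraph D f)" and x0: "x0 \<in> D"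
  obtains r where "r > 0" "\<And>v. v \<in> D \<Longrightarrow> f x0 - 1 - norm (v - x0) / r \<le> f v"
proof -
  have "open (- epigraph D f)" using cl by auto
  moreover have "(x0, f x0 - 1) \<in> - epigraph D f" by (auto simp: epigraph_def)
  ultimately obtain e where e: "e > 0" "ball (x0, f x0 - 1) e \<subseteq> - epigraph D f"
    by (meson open_contains_ball)
  have near: "f x0 - 1 < f v" if "v \<in> D" "norm (v - x0) < e" for v
  proof -
    have "(v, f x0 - 1) \<in> ball (x0, f x0 - 1) e"
      using that by (simp add: dist_Pair_Pair dist_norm norm_minus_commute)
    with e that show ?thesis by (auto simp: epigraph_def)
  qed
  have "f x0 - 1 - norm (v - x0) / (e/2) \<le> f v" if v: "v \<in> D" for v
  proof (cases "norm (v - x0) < e")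
    case True
    moreover have "0 \<le> norm (v - x0) / (e/2)" using e by simp
    ultimately show ?thesis using near[OF v] by linarith
  next
    case False
    \<comment> \<open>This weight places \<open>w\<close> on the segment at distance exactly
      \<open>e/2\<close> from \<open>x0\<close>, inside the range of \<open>near\<close>.\<close>
    define t where "t = (e/2) / norm (v - x0)"
    have n: "norm (v - x0) > 0" using False e by linarith
    have t: "0 < t" "t < 1" using False e n by (auto simp: t_def divide_simps)
    define w where "w = (1 - t) *\<^sub>R x0 + t *\<^sub>R v"
    have "w \<in> D" unfolding w_def
      using f v x0 t by (intro convexD) (auto simp: convex_on_def)
    moreover have "w - x0 = t *\<^sub>R (v - x0)" by (simp add: w_def algebra_simps)
    then have "norm (w - x0) = e/2" using n t e by (simp add: t_def)
    ultimately have "f x0 - 1 < f w" using near e by simp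
    also have "f w \<le> (1 - t) * f x0 + t * f v"
      unfolding w_def using t by (intro convex_onD[OF f]) (use x0 v in auto)
    finally have "t * (f x0 - f v) < 1" by (simp add: algebra_simps)
    then have "f x0 - f v < 1 / t" using t by (simp add: field_simps)
    moreover have "1 / t = norm (v - x0) / (e/2)" by (simp add: t_def)
    ultimately show ?thesis by linarith
  qed
  with that[of "e/2"] e show ?thesis by simp
qed

text \<open>The parallelogram law centred at \<open>u\<close>. Its negative term is the uniform
  convexity that makes minimizing sequences Cauchy.\<close>

lemma sqnorm_midpoint:
  fixes x y u :: "'a::real_inner"
  shows "(norm (midpoint x y - u))\<^sup>2 =
    ((norm (x - u))\<^sup>2 + (norm (y - u))\<^sup>2) / 2 - (norm (x - y))\<^sup>2 / 4"
  unfolding power2_norm_eq_inner midpoint_def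
  by (simp add: inner_diff inner_add inner_commute field_simps)

text \<open>Direct method in the norm topology: the quadratic term beats the linear decrease of
  \<open>f\<close>, so the infimum is finite; it also makes a minimizing sequence Cauchy, and
  completeness and the closed epigraph put its limit in \<open>D\<close> with minimal value.\<close>

lemma prox_minimizer_exists:
  fixes f :: "'a::{real_inner, complete_space} \<Rightarrow> real"
  assumes f: "convex_on D f" and cl: "closed (epigraph D f)" and ne: "D \<noteq> {}"
  obtains p where "p \<in> D"
    "\<And>v. v \<in> D \<Longrightarrow> (norm (p - u))\<^sup>2 / 2 + f p \<le> (norm (v - u))\<^sup>2 / 2 + f v"
proof -
  define F where "F v = (norm (v - u))\<^sup>2 / 2 + f v" for v
  obtain x0 where x0: "x0 \<in> D" using ne by auto
  obtain r where r: "r > 0" "\<And>v. v \<in> D \<Longrightarrow> f x0 - 1 - norm (v - x0) / r \<le> f v"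
    using convex_closed_epigraph_lower_bound[OF f cl x0] by blast
  have bdd: "bdd_below (F ` D)"
  proof (rule bdd_belowI2)
    fix v assume v: "v \<in> D"
    define a where "a = norm (v - u)"
    have "norm (v - x0) \<le> a + norm (x0 - u)"
      unfolding a_def using norm_triangle_ineq4[of "v - u" "x0 - u"] by simp
    then have "norm (v - x0) / r \<le> a / r + norm (x0 - u) / r"
      using r by (simp add: add_divide_distrib[symmetric] divide_right_mono)
    \<comment> \<open>Young's inequality: the linear loss is absorbed by the quadratic term of
      \<open>F\<close> up to a constant.\<close>
    moreover have "a / r \<le> a\<^sup>2 / 2 + (1 / r)\<^sup>2 / 2"
      using sum_squares_bound[of a "1/r"] by simp
    ultimately show "f x0 - 1 - norm (x0 - u) / r - (1 / r)\<^sup>2 / 2 \<le> F v"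
      using r(2)[OF v] by (simp add: F_def a_def)
  qed
  define m where "m = Inf (F ` D)"
  have m: "m \<le> F v" if "v \<in> D" for v
    unfolding m_def using bdd that by (auto intro: cInf_lower)
  have "\<exists>x\<in>D. F x < m + 1 / real (Suc n)" for n
    using cInf_lessD[of "F ` D" "m + 1 / real (Suc n)"] ne by (auto simp: m_def)
  then obtain X where X: "\<And>n. X n \<in> D" "\<And>n. F (X n) < m + 1 / real (Suc n)" by metis
  \<comment> \<open>The value of \<open>F\<close> at the midpoint is at most the mean of
    \<open>F x\<close> and \<open>F y\<close> minus an eighth of the squared distance, yet it cannot
    fall below \<open>m\<close>.\<close>
  have dist2: "(norm (x - y))\<^sup>2 \<le> 4 * (F x - m) + 4 * (F y - m)" if "x \<in> D" "y \<in> D" for x y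
  proof -
    have mid: "midpoint x y = (1 - 1/2) *\<^sub>R x + (1/2) *\<^sub>R y"
      by (simp add: midpoint_def scaleR_add_right)
    have "midpoint x y \<in> D"
      unfolding mid using f that by (intro convexD) (auto simp: convex_on_def)
    moreover have "f (midpoint x y) \<le> (1 - 1/2) * f x + (1/2) * f y"
      unfolding mid by (intro convex_onD[OF f]) (use that in auto)
    ultimately show ?thesis
      using m[of "midpoint x y"] unfolding F_def sqnorm_midpoint by argo
  qed
  have "Cauchy X"
  proof (rule metric_CauchyI)
    fix e :: real assume e: "e > 0"
    \<comment> \<open>With the factors 4 in \<open>dist2\<close>, two excesses below this bound add
      up to less than the square of \<open>e\<close>.\<close>
    then obtain N where N: "inverse (real (Suc N)) < e\<^sup>2 / 8"
      using reals_Archimedean[of "e\<^sup>2 / 8"] by auto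
    have close: "F (X k) - m < e\<^sup>2 / 8" if "k \<ge> N" for k
    proof -
      have "1 / real (Suc k) \<le> inverse (real (Suc N))"
        using that by (simp add: divide_simps)
      with X(2)[of k] N show ?thesis by linarith
    qed
    show "\<exists>N. \<forall>i\<ge>N. \<forall>j\<ge>N. dist (X i) (X j) < e"
    proof (intro exI allI impI)
      fix i j assume ij: "N \<le> i" "N \<le> j"
      have "(norm (X i - X j))\<^sup>2 \<le> 4 * (F (X i) - m) + 4 * (F (X j) - m)"
        by (intro dist2 X)
      also have "\<dots> < 4 * (e\<^sup>2 / 8) + 4 * (e\<^sup>2 / 8)"
        by (intro add_strict_mono mult_strict_left_mono close ij) auto
      also have "\<dots> = e\<^sup>2" by simp
      finally show "dist (X i) (X j) < e"
        unfolding dist_norm by (rule power_less_imp_less_base) (use e in simp)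
    qed
  qed
  then obtain p where p: "X \<longlonglongrightarrow> p" using Cauchy_convergent convergent_def by blast
  have "(\<lambda>n. F (X n)) \<longlonglongrightarrow> m"
  proof (rule tendsto_sandwich)
    show "\<forall>\<^sub>F n in sequentially. m \<le> F (X n)" using m X by simp
    show "\<forall>\<^sub>F n in sequentially. F (X n) \<le> m + 1 / real (Suc n)"
      using X(2) by (simp add: less_imp_le)
    show "(\<lambda>n. m + 1 / real (Suc n)) \<longlonglongrightarrow> m"
      using LIMSEQ_inverse_real_of_nat_add[of m] by (simp add: inverse_eq_divide)
  qed simp
  \<comment> \<open>Convergence of \<open>f (X n)\<close> is read off from that of
    \<open>F (X n)\<close> and of the norms; continuity of \<open>f\<close> is not assumed.
    Closedness of the epigraph then bounds \<open>f p\<close> by this limit.\<close>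
  then have "(\<lambda>n. F (X n) - (norm (X n - u))\<^sup>2 / 2) \<longlonglongrightarrow> m - (norm (p - u))\<^sup>2 / 2"
    by (auto intro!: tendsto_intros p)
  then have lim: "(\<lambda>n. (X n, f (X n))) \<longlonglongrightarrow> (p, m - (norm (p - u))\<^sup>2 / 2)"
    by (intro tendsto_Pair p) (simp add: F_def)
  have "(p, m - (norm (p - u))\<^sup>2 / 2) \<in> epigraph D f"
    by (rule closed_sequentially[OF cl _ lim]) (use X in \<open>simp add: epigraph_def\<close>)
  then have "p \<in> D" "F p \<le> m" by (auto simp: epigraph_def F_def)
  then show ?thesis
    using order_trans[OF _ m] by (intro that[of p]) (auto simp flip: F_def)
qed

text \<open>First-order optimality, saying that \<open>u - p\<close> is a subgradient of
  \<open>f\<close> at \<open>p\<close>: compare \<open>p\<close> with points of the segment towards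
  \<open>v\<close>, divide by the step \<open>t\<close>, and let \<open>t\<close> tend to 0 from the
  right, which removes the quadratic remainder.\<close>

lemma prox_minimizer_variational:
  fixes f :: "'a::real_inner \<Rightarrow> real"
  assumes f: "convex_on D f" and p: "p \<in> D" and v: "v \<in> D"
    and min: "\<And>v. v \<in> D \<Longrightarrow> (norm (p - u))\<^sup>2 / 2 + f p \<le> (norm (v - u))\<^sup>2 / 2 + f v"
  shows "f p + (u - p) \<bullet> (v - p) \<le> f v"
proof -
  have "0 \<le> ((p - u) \<bullet> (v - p) + f v - f p) + t * ((norm (v - p))\<^sup>2 / 2)"
    if t: "0 < t" "t < 1" for t :: real
  proof -
    define w where "w = (1 - t) *\<^sub>R p + t *\<^sub>R v"
    have "w \<in> D" unfolding w_def
      using f p v t by (intro convexD) (auto simp: convex_on_def)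
    moreover have "f w \<le> (1 - t) * f p + t * f v"
      unfolding w_def using t by (intro convex_onD[OF f]) (use p v in auto)
    moreover have "w - u = (p - u) + t *\<^sub>R (v - p)" by (simp add: w_def algebra_simps)
    then have "(norm (w - u))\<^sup>2 =
        (norm (p - u))\<^sup>2 + 2 * t * ((p - u) \<bullet> (v - p)) + t * t * (norm (v - p))\<^sup>2"
      by (simp only: power2_norm_eq_inner)
        (simp add: inner_add inner_commute algebra_simps)
    ultimately have
      "0 \<le> t * (((p - u) \<bullet> (v - p) + f v - f p) + t * ((norm (v - p))\<^sup>2 / 2))"
      using min[of w] by (simp add: algebra_simps)
    with t show ?thesis by (simp add: zero_le_mult_iff)
  qed
  then have ev: "\<forall>\<^sub>F t in at_right (0::real).
      0 \<le> ((p - u) \<bullet> (v - p) + f v - f p) + t * ((norm (v - p))\<^sup>2 / 2)"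
    unfolding eventually_at_right_field by (metis zero_less_one)
  have "((\<lambda>t. ((p - u) \<bullet> (v - p) + f v - f p) + t * ((norm (v - p))\<^sup>2 / 2)) \<longlongrightarrow>
      ((p - u) \<bullet> (v - p) + f v - f p) + 0 * ((norm (v - p))\<^sup>2 / 2)) (at_right (0::real))"
    by (intro tendsto_intros)
  from tendsto_lowerbound[OF this ev] have "0 \<le> (p - u) \<bullet> (v - p) + f v - f p" by simp
  then show ?thesis by (simp add: inner_diff_left)
qed

text \<open>Applied to minus a functional it gives the Riesz representative, applied to the zero
  function on a subspace the orthogonal projection.\<close>

corollary prox_variational_exists:
  fixes f :: "'a::{real_inner, complete_space} \<Rightarrow> real"
  assumes "convex_on D f" "closed (epigraph D f)" "D \<noteq> {}"
  obtains p where "p \<in> D" "\<And>v. v \<in> D \<Longrightarrow> f p + (u - p) \<bullet> (v - p) \<le> f v"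
proof -
  obtain p where p: "p \<in> D"
    "\<And>v. v \<in> D \<Longrightarrow> (norm (p - u))\<^sup>2 / 2 + f p \<le> (norm (v - u))\<^sup>2 / 2 + f v"
    using prox_minimizer_exists[OF assms] by blast
  show ?thesis
    by (rule that[OF p(1)]) (rule prox_minimizer_variational[OF assms(1) p(1) _ p(2)])
qed

section \<open>The proximity operator is nonexpansive\<close>

text \<open>Bridge from extended real values to the real-valued setting of the minimization lemmas:
  restrict to the effective domain, where lower semicontinuity becomes closedness of the
  epigraph.\<close>

lemma proper_closed_convex_on_real:
  fixes \<phi> :: "'a::real_normed_vector \<Rightarrow> ereal"
  assumes \<phi>: "proper_closed_convex_on H \<phi>" and H: "closed H"
  obtains D f where "D \<subseteq> H" "D \<noteq> {}" "convex_on D f" "closed (epigraph D f)"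
    "\<And>x. x \<in> H \<Longrightarrow> \<phi> x = (if x \<in> D then ereal (f x) else \<infinity>)"
proof -
  define D where "D = edom_on H \<phi>"
  define f where "f x = real_of_ereal (\<phi> x)" for x
  have minf: "\<And>u. u \<in> H \<Longrightarrow> \<phi> u \<noteq> -\<infinity>" and ne: "D \<noteq> {}"
    using \<phi> by (auto simp: proper_closed_convex_on_def proper_on_def D_def)
  have DH: "D \<subseteq> H" by (auto simp: D_def edom_on_def)
  have eq: "\<phi> x = (if x \<in> D then ereal (f x) else \<infinity>)" if "x \<in> H" for x
    using minf[OF that] that by (cases "\<phi> x") (auto simp: D_def edom_on_def f_def)
  have cH: "convex H" using \<phi> by (auto simp: proper_closed_convex_on_def econvex_on_def)
  have conv: "s *\<^sub>R x + t *\<^sub>R y \<in> D \<and> f (s *\<^sub>R x + t *\<^sub>R y) \<le> s * f x + t * f y"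
    if "x \<in> D" "y \<in> D" "s > 0" "t > 0" "s + t = 1" for x y s t
  proof -
    have z: "s *\<^sub>R x + t *\<^sub>R y \<in> H" using that DH by (intro convexD[OF cH]) auto
    have "\<phi> (s *\<^sub>R x + t *\<^sub>R y) \<le> ereal s * \<phi> x + ereal t * \<phi> y"
      using \<phi> that DH unfolding proper_closed_convex_on_def econvex_on_def by blast
    then show ?thesis
      using that DH by (auto simp: eq[OF z] eq subset_iff split: if_splits)
  qed
  have "convex D"
    unfolding convex_alt
  proof (intro ballI allI impI)
    fix x y and t :: real assume "x \<in> D" "y \<in> D" "0 \<le> t \<and> t \<le> 1"
    then show "(1 - t) *\<^sub>R x + t *\<^sub>R y \<in> D"
      \<comment> \<open>\<open>conv\<close> covers only strictly positive weights, so the endpoints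
        are separate.\<close>
      using conv[of x y "1 - t" t] by (cases "t = 0 \<or> t = 1") auto
  qed
  then have "convex_on D f"
    using conv by (intro convex_onI) auto
  moreover have "closed (epigraph D f)"
    unfolding closed_sequential_limits
  proof (intro allI impI, elim conjE)
    fix Z :: "nat \<Rightarrow> 'a \<times> real" and z
    assume Z: "\<forall>n. Z n \<in> epigraph D f" and lim: "Z \<longlonglongrightarrow> z"
    obtain x r where z: "z = (x, r)" by fastforce
    have X: "(\<lambda>n. fst (Z n)) \<longlonglongrightarrow> x" and R: "(\<lambda>n. snd (Z n)) \<longlonglongrightarrow> r"
      using tendsto_fst[OF lim] tendsto_snd[OF lim] z by auto
    have ZD: "fst (Z n) \<in> D" "f (fst (Z n)) \<le> snd (Z n)" for n
      using Z by (auto simp: epigraph_def)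
    have xH: "x \<in> H" using closed_sequentially[OF H _ X] ZD DH by blast
    have "\<phi> x \<le> ereal r"
    proof (rule ccontr)
      assume "\<not> \<phi> x \<le> ereal r"
      \<comment> \<open>A level strictly between the limiting height and \<open>\<phi> x\<close>:
        semicontinuity keeps \<open>\<phi>\<close> above \<open>c\<close> near \<open>x\<close>,
        while the heights \<open>snd (Z n)\<close> eventually drop below it.\<close>
      then obtain c where c: "ereal r < ereal c" "ereal c < \<phi> x"
        by (metis ereal_dense2 not_le)
      have "\<phi> x \<le> Liminf (at x within H) \<phi>"
        using \<phi> xH by (auto simp: proper_closed_convex_on_def lsc_on_def)
      then have "\<forall>\<^sub>F y in at x within H. ereal c < \<phi> y"
        using c by (simp add: le_Liminf_iff)
      \<comment> \<open>The filter \<open>at x within H\<close> omits \<open>x\<close>; there the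
        bound comes from the choice of \<open>c\<close>.\<close>
      then obtain B where B: "open B" "x \<in> B" "\<And>y. y \<in> B \<Longrightarrow> y \<in> H \<Longrightarrow> ereal c < \<phi> y"
        using c unfolding eventually_at_topological by metis
      have "\<forall>\<^sub>F n in sequentially. fst (Z n) \<in> B \<and> snd (Z n) < c"
        using topological_tendstoD[OF X B(1,2)] order_tendstoD(2)[OF R, of c] c
        by (auto intro: eventually_conj)
      then obtain n where n: "fst (Z n) \<in> B" "snd (Z n) < c"
        using eventually_sequentially by auto
      have "ereal c < ereal (f (fst (Z n)))"
        using B(3)[OF n(1)] ZD(1)[of n] DH by (auto simp: eq subset_iff)
      then show False using n ZD(2)[of n] by simp
    qed
    then show "z \<in> epigraph D f"
      using eq[OF xH] by (auto simp: z epigraph_def split: if_splits)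
  qed
  ultimately show ?thesis using that DH ne eq by blast
qed

lemma proper_closed_convex_on_real_divide:
  fixes \<phi> :: "'a::real_normed_vector \<Rightarrow> ereal"
  assumes \<phi>: "proper_closed_convex_on H \<phi>" and H: "closed H" and \<tau>: "\<tau> > 0"
  obtains D f where "D \<subseteq> H" "D \<noteq> {}" "convex_on D f" "closed (epigraph D f)"
    "\<And>x. x \<in> H \<Longrightarrow> \<phi> x / ereal \<tau> = (if x \<in> D then ereal (f x) else \<infinity>)"
proof -
  obtain D f where Df: "D \<subseteq> H" "D \<noteq> {}" "convex_on D f" "closed (epigraph D f)"
    "\<And>x. x \<in> H \<Longrightarrow> \<phi> x = (if x \<in> D then ereal (f x) else \<infinity>)"
    using proper_closed_convex_on_real[OF \<phi> H] by blast
  have "convex_on D (\<lambda>x. f x / \<tau>)"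
    using convex_on_cmul[OF _ Df(3), of "1 / \<tau>"] \<tau> by simp
  moreover have "epigraph D (\<lambda>x. f x / \<tau>) = (\<lambda>z. (fst z, \<tau> * snd z)) -` epigraph D f"
    using \<tau> by (auto simp: epigraph_def field_simps)
  moreover have "closed ((\<lambda>z. (fst z, \<tau> * snd z)) -` epigraph D f)"
    by (intro continuous_closed_vimage Df(4) continuous_intros)
  ultimately show ?thesis
    using that[of D "\<lambda>x. f x / \<tau>"] Df \<tau> by simp
qed

text \<open>\<open>prox_on\<close> selects a minimizer by a choice operator, so its properties rest
  on existence. The optimality inequality holds for whichever minimizer is selected.\<close>

lemma prox_on_variational:
  fixes f :: "'a::{real_inner, complete_space} \<Rightarrow> real"
  assumes Df: "D \<subseteq> H" "D \<noteq> {}" "convex_on D f" "closed (epigraph D f)"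
    and \<phi>: "\<And>x. x \<in> H \<Longrightarrow> \<phi> x = (if x \<in> D then ereal (f x) else \<infinity>)"
  shows "prox_on H \<phi> u \<in> D"
    and "v \<in> D \<Longrightarrow> f (prox_on H \<phi> u) + (u - prox_on H \<phi> u) \<bullet> (v - prox_on H \<phi> u) \<le> f v"
proof -
  define F where "F v = ereal ((1/2) * (norm (v - u))\<^sup>2) + \<phi> v" for v
  have FD: "F v = ereal ((norm (v - u))\<^sup>2 / 2 + f v)" if "v \<in> D" for v
    using that Df(1) \<phi> by (auto simp: F_def)
  have Fi: "F v = \<infinity>" if "v \<in> H" "v \<notin> D" for v
    using that \<phi> by (auto simp: F_def)
  obtain p where p: "p \<in> D"
    "\<And>v. v \<in> D \<Longrightarrow> (norm (p - u))\<^sup>2 / 2 + f p \<le> (norm (v - u))\<^sup>2 / 2 + f v"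
    using prox_minimizer_exists[OF Df(3,4,2)] by blast
  have "F p \<le> F v" if "v \<in> H" for v
    using p that by (cases "v \<in> D") (auto simp: FD Fi)
  then have "is_arg_min F (\<lambda>x. x \<in> H) p"
    using p Df(1) by (auto simp: is_arg_min_linorder)
  then have "is_arg_min F (\<lambda>x. x \<in> H) (prox_on H \<phi> u)"
    unfolding prox_on_def arg_min_on_def arg_min_def F_def by (rule someI)
  then have q: "prox_on H \<phi> u \<in> H" "\<And>v. v \<in> H \<Longrightarrow> F (prox_on H \<phi> u) \<le> F v"
    by (auto simp: is_arg_min_linorder)
  show D: "prox_on H \<phi> u \<in> D"
    \<comment> \<open>The finite value at \<open>p\<close> excludes a selected point of infinite
      value.\<close>
    using q(2)[of p] p(1) Df(1) Fi[OF q(1)] FD[OF p(1)] by fastforce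
  show "f (prox_on H \<phi> u) + (u - prox_on H \<phi> u) \<bullet> (v - prox_on H \<phi> u) \<le> f v" if "v \<in> D"
  proof (rule prox_minimizer_variational[OF Df(3) D that])
    fix w assume "w \<in> D"
    then show "(norm (prox_on H \<phi> u - u))\<^sup>2 / 2 + f (prox_on H \<phi> u) \<le> (norm (w - u))\<^sup>2 / 2 + f w"
      using q(2)[of w] Df(1) D by (auto simp: FD)
  qed
qed

lemma norm_le_of_inner_self:
  fixes a b :: "'a::real_inner"
  assumes "a \<bullet> a \<le> b \<bullet> a"
  shows "norm a \<le> norm b"
proof (cases "a = 0")
  case False
  have "norm a * norm a \<le> norm b * norm a"
    using assms norm_cauchy_schwarz[of b a] by (simp add: power2_norm_eq_inner flip: power2_eq_square)
  with False show ?thesis by simp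
qed simp

text \<open>Test the optimality inequality at \<open>u\<close> with \<open>P w\<close> and the one
  at \<open>w\<close> with \<open>P u\<close>, then add: the values of \<open>f\<close> cancel,
  leaving firm nonexpansiveness, and Cauchy-Schwarz does the rest.\<close>

lemma prox_on_nonexpansive:
  fixes \<phi> :: "'a::{real_inner, complete_space} \<Rightarrow> ereal"
  assumes \<phi>: "proper_closed_convex_on H \<phi>" and H: "closed H" and \<tau>: "\<tau> > 0"
  shows "norm (prox_on H (\<lambda>x. \<phi> x / ereal \<tau>) u - prox_on H (\<lambda>x. \<phi> x / ereal \<tau>) w) \<le> norm (u - w)"
proof -
  obtain D f where Df: "D \<subseteq> H" "D \<noteq> {}" "convex_on D f" "closed (epigraph D f)"
    "\<And>x. x \<in> H \<Longrightarrow> \<phi> x / ereal \<tau> = (if x \<in> D then ereal (f x) else \<infinity>)"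
    using proper_closed_convex_on_real_divide[OF assms] by blast
  define P where "P = prox_on H (\<lambda>x. \<phi> x / ereal \<tau>)"
  have P: "P x \<in> D" "v \<in> D \<Longrightarrow> f (P x) + (x - P x) \<bullet> (v - P x) \<le> f v" for x v
    unfolding P_def using prox_on_variational[OF Df] by blast+
  have "(u - P u) \<bullet> (P w - P u) + (w - P w) \<bullet> (P u - P w) \<le> 0"
    using P(2)[OF P(1), of u w] P(2)[OF P(1), of w u] by linarith
  then have "(P u - P w) \<bullet> (P u - P w) \<le> (u - w) \<bullet> (P u - P w)"
    by (simp add: inner_diff algebra_simps inner_commute)
  then show ?thesis unfolding P_def by (rule norm_le_of_inner_self)
qed

section \<open>Riesz representatives and orthogonal projections\<close>

text \<open>The representative minimizes half the squared norm minus \<open>l\<close>. Its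
  optimality condition bounds \<open>l v\<close> by \<open>v \<bullet> p\<close> for all
  \<open>v\<close>, and the instance \<open>- v\<close> reverses the inequality.\<close>

lemma Riesz_representation:
  fixes l :: "'a::{real_inner, complete_space} \<Rightarrow> real"
  assumes l: "bounded_linear l"
  obtains g where "l = (\<lambda>v. v \<bullet> g)"
proof -
  interpret bounded_linear l by fact
  have "convex_on UNIV (\<lambda>v. - l v)"
    by (intro convex_onI) (auto simp: add scaleR)
  moreover have "closed (epigraph UNIV (\<lambda>v. - l v))"
  proof -
    have "closed {z. - l (fst z) \<le> snd z}"
      by (intro closed_Collect_le continuous_intros
          bounded_linear.continuous_on[OF l])
    then show ?thesis by (simp add: epigraph_def)
  qed
  ultimately obtain p where p: "\<And>v. - l p + (0 - p) \<bullet> (v - p) \<le> - l v"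
    using prox_variational_exists[of UNIV "\<lambda>v. - l v" 0] by auto
  have le: "l v \<le> v \<bullet> p" for v
    using p[of "p + v"] by (simp add: add inner_commute)
  have "l v = v \<bullet> p" for v
    using le[of v] le[of "- v"] by (simp add: neg)
  then show ?thesis using that by blast
qed

lemma orth_proj_eqI:
  fixes H :: "'a::real_inner set"
  assumes H: "subspace H" and p: "p \<in> H" "\<And>v. v \<in> H \<Longrightarrow> orthogonal (u - p) v"
  shows "orth_proj H u = p"
  unfolding orth_proj_def
proof (rule the_equality)
  show "p \<in> H \<and> (\<forall>v\<in>H. orthogonal (u - p) v)" using p by simp
  fix q assume q: "q \<in> H \<and> (\<forall>v\<in>H. orthogonal (u - q) v)"
  have "q - p \<in> H" using H q p subspace_diff by blast
  then have "(u - p) \<bullet> (q - p) = 0" "(u - q) \<bullet> (q - p) = 0"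
    using q p by (auto simp: orthogonal_def)
  then have "(q - p) \<bullet> (q - p) = 0" by (simp add: inner_diff)
  then show "q = p" by simp
qed

text \<open>The projection is the proximal point of the zero function on \<open>H\<close>. On a
  subspace the test directions \<open>v\<close> and \<open>- v\<close> are both admissible, so the
  variational inequality becomes orthogonality.\<close>

lemma orth_proj:
  fixes H :: "'a::{real_inner, complete_space} set"
  assumes H: "subspace H" "closed H"
  shows orth_proj_mem: "orth_proj H u \<in> H"
    and orth_proj_inner: "v \<in> H \<Longrightarrow> v \<bullet> orth_proj H u = v \<bullet> u"
proof -
  have "convex_on H (\<lambda>_. 0)"
    using H subspace_imp_convex by (intro convex_onI) auto
  moreover have "epigraph H (\<lambda>_. 0) = H \<times> {0..}" by (auto simp: epigraph_def)
  moreover have "closed (H \<times> {0::real..})" using H by (intro closed_Times) auto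
  moreover have "H \<noteq> {}" using H subspace_0 by blast
  ultimately obtain p where p: "p \<in> H" "\<And>v. v \<in> H \<Longrightarrow> (u - p) \<bullet> (v - p) \<le> 0"
    using prox_variational_exists[of H "\<lambda>_. 0" u] by auto
  have le: "(u - p) \<bullet> v \<le> 0" if "v \<in> H" for v
    using p(2)[of "p + v"] that p H subspace_add by fastforce
  have orth: "orthogonal (u - p) v" if "v \<in> H" for v
    using le[OF that] le[of "- v"] that H by (simp add: subspace_neg orthogonal_def)
  have eq: "orth_proj H u = p" using orth_proj_eqI[OF H(1) p(1) orth] .
  show "orth_proj H u \<in> H" using eq p by simp
  show "v \<bullet> orth_proj H u = v \<bullet> u" if "v \<in> H"
    using orth[OF that] by (simp add: eq orthogonal_def inner_diff_left inner_commute[of v])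
qed

lemma orth_proj_nonexpansive:
  fixes H :: "'a::{real_inner, complete_space} set"
  assumes H: "subspace H" "closed H"
  shows "norm (orth_proj H a - orth_proj H b) \<le> norm (a - b)"
proof (rule norm_le_of_inner_self)
  let ?d = "orth_proj H a - orth_proj H b"
  have "?d \<in> H" using H orth_proj_mem subspace_diff by blast
  then have "?d \<bullet> ?d = ?d \<bullet> (a - b)"
    using orth_proj_inner[OF H] by (simp only: inner_diff_right)
  then show "?d \<bullet> ?d \<le> (a - b) \<bullet> ?d" by (simp add: inner_commute)
qed

text \<open>Derivatives within a proper subspace are not unique as maps on the whole space;
  membership in \<open>H\<close> restores uniqueness. Along the line through \<open>u\<close> with
  direction \<open>d = k - g\<close>, which stays in \<open>H\<close>, the derivative in one real
  variable is unique and forces \<open>d \<bullet> d = 0\<close>.\<close>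

lemma grad_on_eqI:
  fixes H :: "'a::real_inner set"
  assumes H: "subspace H" and u: "u \<in> H" and g: "g \<in> H"
    and der: "(f has_derivative (\<lambda>v. v \<bullet> g)) (at u within H)"
  shows "grad_on H f u = g"
  unfolding grad_on_def
proof (rule the_equality)
  show "g \<in> H \<and> (f has_derivative (\<lambda>v. v \<bullet> g)) (at u within H)" using g der by simp
  fix k assume k: "k \<in> H \<and> (f has_derivative (\<lambda>v. v \<bullet> k)) (at u within H)"
  define d where "d = k - g"
  have d: "d \<in> H" unfolding d_def using H k g subspace_diff by blast
  define c where "c t = u + t *\<^sub>R d" for t :: real
  have range: "range c \<subseteq> H" unfolding c_def using H u d by (auto intro: subspace_add subspace_scale)
  have c: "(c has_derivative (\<lambda>t. t *\<^sub>R d)) (at 0)"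
    unfolding c_def by (auto intro!: derivative_eq_intros)
  have fc: "((\<lambda>t. f (c t)) has_derivative (\<lambda>t. (t *\<^sub>R d) \<bullet> a)) (at 0)"
    if "(f has_derivative (\<lambda>v. v \<bullet> a)) (at u within H)" for a
  proof -
    have "(f has_derivative (\<lambda>v. v \<bullet> a)) (at (c 0) within range c)"
      using has_derivative_subset[OF that range] by (simp add: c_def)
    from diff_chain_within[OF c this] show ?thesis by (simp add: o_def)
  qed
  have "(\<lambda>t. (t *\<^sub>R d) \<bullet> k) = (\<lambda>t. (t *\<^sub>R d) \<bullet> g)"
    using has_derivative_unique[OF fc fc] k der by blast
  from fun_cong[OF this, of 1] have "d \<bullet> d = 0" by (simp add: d_def inner_diff_right)
  then show "k = g" by (simp add: d_def)
qed

text \<open>Within \<open>H\<close> only increments \<open>y - u\<close> from \<open>H\<close>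
  matter, and their inner products with a vector and with its projection agree. This identifies the
  discrete gradient as the projected full gradient.\<close>

lemma grad_on_subspace:
  fixes H :: "'a::{real_inner, complete_space} set"
  assumes H: "subspace H" "closed H" and u: "u \<in> H" and f: "f differentiable (at u)"
  shows "grad_on H f u = orth_proj H (grad_on UNIV f u)"
proof -
  obtain l where l: "(f has_derivative l) (at u)" using f by (auto simp: differentiable_def)
  obtain g where g: "l = (\<lambda>v. v \<bullet> g)"
    using Riesz_representation[OF has_derivative_bounded_linear[OF l]] .
  have eq: "grad_on UNIV f u = g" using l g by (intro grad_on_eqI) auto
  have "(f has_derivative (\<lambda>v. v \<bullet> g)) (at u within H)"
    using l g has_derivative_at_withinI by blast
  then have "(f has_derivative (\<lambda>v. v \<bullet> orth_proj H g)) (at u within H)"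
    unfolding has_derivative_within
  proof (elim conjE, intro conjI)
    assume lim: "((\<lambda>y. (1 / norm (y - u)) *\<^sub>R (f y - (f u + (y - u) \<bullet> g))) \<longlongrightarrow> 0) (at u within H)"
    show "((\<lambda>y. (1 / norm (y - u)) *\<^sub>R (f y - (f u + (y - u) \<bullet> orth_proj H g))) \<longlongrightarrow> 0) (at u within H)"
    proof (rule Lim_transform_within[OF lim zero_less_one])
      fix y assume "y \<in> H"
      then have "y - u \<in> H" using H u subspace_diff by blast
      then show "(1 / norm (y - u)) *\<^sub>R (f y - (f u + (y - u) \<bullet> g)) =
          (1 / norm (y - u)) *\<^sub>R (f y - (f u + (y - u) \<bullet> orth_proj H g))"
        using orth_proj_inner[OF H] by simp
    qed
  qed (rule bounded_linear_inner_left)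
  then show ?thesis
    unfolding eq using H u by (intro grad_on_eqI orth_proj_mem)
qed

lemma reduced_obj_differentiable:
  assumes J: "C1_into J UNIV UNIV" and S: "C1_into S V T" and u: "u \<in> V"
  shows "reduced_obj J S differentiable (at u)"
proof -
  obtain S' where S': "(S has_derivative S') (at u)"
    using S u unfolding C1_into_def by blast
  obtain J' where J': "(J has_derivative J') (at (S u, u))"
    using J unfolding C1_into_def by blast
  have "((\<lambda>x. (S x, x)) has_derivative (\<lambda>x. (S' x, x))) (at u)"
    by (intro has_derivative_Pair S' has_derivative_ident)
  from has_derivative_compose[OF this J'] show ?thesis
    by (auto simp: differentiable_def reduced_obj_def[abs_def])
qed

section \<open>Comparison of the criticality measures\<close>

text \<open>The type \<open>'w\<close> with the injection \<open>\<iota>\<close> models the densely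
  embedded space with its own norm, so regularity of a gradient means having a preimage under
  \<open>\<iota>\<close> of bounded norm.\<close>

theorem theorem2:
  fixes J :: "('y::banach) \<times> ('u::{real_inner, complete_space}) \<Rightarrow> real"
    and S :: "'u \<Rightarrow> 'y"
    and VU WU :: "'u set"
    and \<psi> :: "'u \<Rightarrow> ereal"
    and Uh :: "real \<Rightarrow> 'u set"
    and Yh :: "real \<Rightarrow> 'y set"
    and Sh :: "real \<Rightarrow> 'u \<Rightarrow> 'y"
    and \<psi>h :: "real \<Rightarrow> 'u \<Rightarrow> ereal"
    and \<iota> :: "('w::banach) \<Rightarrow> 'u"
    and \<rho>_Pi \<rho>_grad \<rho>_prox :: "real \<Rightarrow> real"
    and \<tau> L_grad l_grad :: real
  assumes sep_U: "separable_space (euclidean :: 'u topology)"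
    and sep_Y: "separable_space (euclidean :: 'y topology)"
    and \<psi>: "proper_closed_convex_on UNIV \<psi>"
    and open_VU: "open VU"
    and dom_\<psi>_VU: "edom_on UNIV \<psi> \<subseteq> VU"
    and C1_J: "C1_into J UNIV UNIV"
    and C1_S: "C1_into S VU UNIV"
    and Uh_subspace: "\<And>h. h > 0 \<Longrightarrow> subspace (Uh h)"
    and Uh_closed: "\<And>h. h > 0 \<Longrightarrow> closed (Uh h)"
    and Yh_subspace: "\<And>h. h > 0 \<Longrightarrow> subspace (Yh h)"
    and \<psi>h: "\<And>h. h > 0 \<Longrightarrow> proper_closed_convex_on (Uh h) (\<psi>h h)"
    and dom_\<psi>h_VU: "\<And>h. h > 0 \<Longrightarrow> edom_on (Uh h) (\<psi>h h) \<subseteq> VU"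
    and C1_Sh: "\<And>h. h > 0 \<Longrightarrow> C1_into (Sh h) VU (Yh h)"
    and \<tau>_pos: "\<tau> > 0"
    \<comment> \<open>(1)\<close>
    and refl_W: "reflexive_space TYPE('w)"
    and \<iota>_lin: "bounded_linear \<iota>"
    and \<iota>_inj: "inj \<iota>"
    and \<iota>_dense: "closure (range \<iota>) = UNIV"
    and rate_Pi: "rate_fun \<rho>_Pi"
    and Pi_err: "\<And>h w. h > 0 \<Longrightarrow> norm (orth_proj (Uh h) (\<iota> w) - \<iota> w) \<le> \<rho>_Pi h * norm w"
    \<comment> \<open>(2)\<close>
    and WU_VU: "WU \<subseteq> VU"
    and WU_bounded: "bounded WU"
    and dom_\<psi>_WU: "edom_on UNIV \<psi> \<subseteq> WU"
    and dom_\<psi>h_WU: "\<And>h. h > 0 \<Longrightarrow> edom_on (Uh h) (\<psi>h h) \<subseteq> WU"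
    and L_pos: "L_grad > 0"
    and grad_Lipschitz: "L_grad-lipschitz_on WU (grad_on UNIV (reduced_obj J S))"
    and l_pos: "l_grad > 0"
    and grad_regular: "\<And>h v. h > 0 \<Longrightarrow> v \<in> WU \<inter> Uh h \<Longrightarrow>
          \<exists>w. \<iota> w = grad_on UNIV (reduced_obj J S) v \<and> norm w \<le> l_grad"
    and rate_grad: "rate_fun \<rho>_grad"
    and grad_err: "\<And>h v. h > 0 \<Longrightarrow> v \<in> WU \<inter> Uh h \<Longrightarrow>
          norm (grad_on UNIV (reduced_obj J (Sh h)) v - grad_on UNIV (reduced_obj J S) v) \<le> \<rho>_grad h"
    \<comment> \<open>(3)\<close>
    and rate_prox: "rate_fun \<rho>_prox"
    and prox_err: "\<And>h v. h > 0 \<Longrightarrow> v \<in> Uh h \<Longrightarrow>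
          norm (prox_on UNIV (\<lambda>x. \<psi> x / ereal \<tau>) v - prox_on (Uh h) (\<lambda>x. \<psi>h h x / ereal \<tau>) v)
            \<le> \<rho>_prox h"
  shows "\<forall>h>0. \<forall>u \<in> WU \<inter> Uh h.
           chi_can UNIV \<psi> (reduced_obj J S) u \<tau>
             \<le> chi_can (Uh h) (\<psi>h h) (reduced_obj J (Sh h)) u \<tau>
               + (1/\<tau>) * \<rho>_grad h + \<rho>_prox h + (1/\<tau>) * \<rho>_Pi h * l_grad"
proof (intro allI impI ballI)
  fix h :: real and u assume h: "h > 0" and u: "u \<in> WU \<inter> Uh h"
  note H = Uh_subspace[OF h] Uh_closed[OF h]
  define g where "g = grad_on UNIV (reduced_obj J S) u"
  define gh where "gh = grad_on UNIV (reduced_obj J (Sh h)) u"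
  define p where "p = grad_on (Uh h) (reduced_obj J (Sh h)) u"
  define P where "P = prox_on UNIV (\<lambda>x. \<psi> x / ereal \<tau>)"
  define Q where "Q = prox_on (Uh h) (\<lambda>x. \<psi>h h x / ereal \<tau>)"
  define x where "x = u - (1/\<tau>) *\<^sub>R g"
  define y where "y = u - (1/\<tau>) *\<^sub>R p"
  have p: "p = orth_proj (Uh h) gh"
    unfolding p_def gh_def using u WU_VU
    by (intro grad_on_subspace H reduced_obj_differentiable[OF C1_J C1_Sh[OF h]]) auto
  have proj_err: "norm (orth_proj (Uh h) g - g) \<le> \<rho>_Pi h * l_grad"
  proof -
    obtain w where w: "\<iota> w = g" "norm w \<le> l_grad"
      using grad_regular[OF h u] unfolding g_def by blast
    have "norm (orth_proj (Uh h) g - g) \<le> \<rho>_Pi h * norm w" using Pi_err[OF h, of w] w by simp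
    also have "\<dots> \<le> \<rho>_Pi h * l_grad"
      using w rate_Pi h by (intro mult_left_mono) (auto simp: rate_fun_def image_subset_iff)
    finally show ?thesis .
  qed
  \<comment> \<open>Both vectors are projections, of \<open>gh\<close> and of \<open>g\<close>, so
    the gradient error passes through without growth.\<close>
  have "norm (p - orth_proj (Uh h) g) \<le> \<rho>_grad h"
    unfolding p using orth_proj_nonexpansive[OF H, of gh g] grad_err[OF h u]
    unfolding g_def gh_def by linarith
  then have pg: "norm (p - g) \<le> \<rho>_grad h + \<rho>_Pi h * l_grad"
    using proj_err norm_triangle_ineq[of "p - orth_proj (Uh h) g" "orth_proj (Uh h) g - g"] by simp
  have "norm (P y - P x) \<le> norm (y - x)"
    unfolding P_def by (rule prox_on_nonexpansive[OF \<psi> closed_UNIV \<tau>_pos])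
  also have "y - x = (1/\<tau>) *\<^sub>R (g - p)" by (simp add: x_def y_def algebra_simps)
  also have "norm \<dots> = (1/\<tau>) * norm (p - g)" using \<tau>_pos by (simp add: norm_minus_commute)
  also have "\<dots> \<le> (1/\<tau>) * (\<rho>_grad h + \<rho>_Pi h * l_grad)"
    using pg \<tau>_pos by (intro mult_left_mono) auto
  finally have Pyx: "norm (P y - P x) \<le> (1/\<tau>) * \<rho>_grad h + (1/\<tau>) * \<rho>_Pi h * l_grad"
    by (simp add: algebra_simps)
  have "p \<in> Uh h" unfolding p by (rule orth_proj_mem[OF H])
  \<comment> \<open>\<open>prox_err\<close> compares the two operators only at points of
    \<open>Uh h\<close>; \<open>y\<close> qualifies since the discrete gradient lies there, whereas
    \<open>x\<close> need not.\<close>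
  then have "y \<in> Uh h" unfolding y_def using u H by (auto intro: subspace_diff subspace_scale)
  then have "norm (P y - Q y) \<le> \<rho>_prox h" unfolding P_def Q_def by (rule prox_err[OF h])
  \<comment> \<open>The path runs from \<open>u\<close> through \<open>Q y\<close> and
    \<open>P y\<close> to \<open>P x\<close>.\<close>
  moreover have "norm (u - P x) \<le> norm (u - Q y) + norm (P y - Q y) + norm (P y - P x)"
    by norm
  ultimately have "norm (u - P x) \<le> norm (u - Q y)
      + (1/\<tau>) * \<rho>_grad h + \<rho>_prox h + (1/\<tau>) * \<rho>_Pi h * l_grad"
    using Pyx by linarith
  then show "chi_can UNIV \<psi> (reduced_obj J S) u \<tau>
      \<le> chi_can (Uh h) (\<psi>h h) (reduced_obj J (Sh h)) u \<tau>
        + (1/\<tau>) * \<rho>_grad h + \<rho>_prox h + (1/\<tau>) * \<rho>_Pi h * l_grad"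
    by (simp add: chi_can_def P_def Q_def x_def y_def g_def p_def)
qed

end
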